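(* Let $\mathbb{A}=(A_1,\dots,A_m)$, where $A_i\in M_n(\mathbb{R}_+)$ for all $i=1,\dots,m$, and let $C\in M_n(\mathbb{R}_+)$. Then the following assertions hold. (i) $W_{\max}^C(A_1\oplus\alpha_1I,\dots,A_m\oplus\alpha_mI)=W_{\max}^C(A_1,\dots,A_m)\oplus\{(\alpha_1,\dots,\alpha_m)\,tr_{\otimes}(C)\}$, where $\alpha_1,\dots,\alpha_m\in\mathbb{R}_+$. (ii) $W_{\max}^C(\mathbb{A}\oplus\mathbb{B})\subseteq W_{\max}^C(\mathbb{A})\oplus W_{\max}^C(\mathbb{B})$ and $W_{\max}^{C\oplus D}(\mathbb{A})\subseteq W_{\max}^C(\mathbb{A})\oplus W_{\max}^D(\mathbb{A})$, where $\mathbb{B}=(B_1,\dots,B_m)$ with $B_i\in M_n(\mathbb{R}_+)$ for all $i=1,\dots,m$, and $D\in M_n(\mathbb{R}_+)$. (iii) $W_{\max}^C(U^t\otimes A_1\otimes U,\dots,U^t\otimes A_m\otimes U)=W_{\max}^C(A_1,\dots,A_m)$, where $U\in\mathcal{U}_n$. (iv) $W_{\max}^C(A_1^t,\dots,A_m^t)=W_{\max}^{C^t}(A_1,\dots,A_m)$. (v) If $C=\alpha I_n$ for $\alpha\in\mathbb{R}_+$, then $W_{\max}^C(\mathbb{A})=\{\alpha(tr_{\otimes}(A_1),\dots,tr_{\otimes}(A_m))\}$. (vi) $W_{\max}^{(\alpha C\oplus\beta I)}(\mathbb{A})=\alpha W_{\max}^C(\mathbb{A})\oplus\{\beta(tr_{\otimes}(A_1),\dots,tr_{\otimes}(A_m))\}$,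 where $\alpha,\beta\in\mathbb{R}_+$. (vii) $W_{\max}^{V^t\otimes C\otimes V}(\mathbb{A})=W_{\max}^C(\mathbb{A})$, where $V\in\mathcal{U}_n$.
   Context: $\mathbb{R}_+=[0,\infty)$; $M_n(\mathbb{R}_+)$ is the set of $n\times n$ matrices with entries in $\mathbb{R}_+$. For scalars $a\oplus b=\max\{a,b\}$; for matrices or vectors $\oplus$ is the entrywise maximum, and $(A\otimes B)_{ij}=\max_k a_{ik}b_{kj}$. $X^t$ is the transpose, $I=I_n$ is the identity matrix, and $tr_{\otimes}(A)=\max_i a_{ii}$. For tuples of matrices, $\mathbb{A}\oplus\mathbb{B}=(A_1\oplus B_1,\dots,A_m\oplus B_m)$; for sets $S,T\subseteq\mathbb{R}_+^m$ and $\alpha\in\mathbb{R}_+$, $S\oplus T=\{s\oplus t:s\in S,t\in T\}$ and $\alpha S=\{\alpha s:s\in S\}$. $\mathcal{U}_n=\{X\in M_n(\mathbb{R}_+):X^t\otimes X=I_n\}$ (which is the set of $n\times n$ permutation matrices). The max joint $C$-numerical range of $\mathbb{A}=(A_1,\dots,A_m)$ is \[ W_{\max}^C(\mathbb{A})=\{(tr_{\otimes}(C\otimes X^t\otimes A_1\otimes X),\dots,tr_{\otimes}(C\otimes X^t\otimes A_m\otimes X)): X\in\mathcal{U}_n\}. \] *)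

theory Defs
  imports "HOL-Analysis.Analysis"
begin

text \<open>
  Matrices in $M_n$ have type \<open>real^'n^'n\<close>, $m$-tuples of matrices have type \<open>(real^'n^'n)^'m\<close>,
  and points of the numerical range have type \<open>real^'m\<close>.  On all of these types \<open>sup\<close> is the
  entrywise maximum (see \<open>max_plus_real\<close>, \<open>max_plus_component\<close> below), so one notation
  covers scalars, vectors, matrices and tuples.  It must not be applied to sets, where \<open>sup\<close> is union;
  the elementwise operation on sets is \<open>max_plus_set\<close>.
\<close>

abbreviation max_plus :: "'a::semilattice_sup \<Rightarrow> 'a \<Rightarrow> 'a"  (infixl "\<oplus>" 65)
  where "x \<oplus> y \<equiv> sup x y"

lemma max_plus_real: "(a::real) \<oplus> b = max a b"
  by (simp add: sup_max)

lemma max_plus_component: "((x::'a::ordered_euclidean_space^'k) \<oplus> y) $ i = x $ i \<oplus> y $ i"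
  by (simp add: sup_vec_def)

definition max_plus_set :: "'a::semilattice_sup set \<Rightarrow> 'a set \<Rightarrow> 'a set"  (infixl "\<oplus>\<^sub>S" 65)
  where "S \<oplus>\<^sub>S T = {s \<oplus> t | s t. s \<in> S \<and> t \<in> T}"

definition scale_set :: "real \<Rightarrow> 'a::real_vector set \<Rightarrow> 'a set"  (infixr "*\<^sub>S" 75)
  where "\<alpha> *\<^sub>S S = {\<alpha> *\<^sub>R s | s. s \<in> S}"

definition nonneg_mat :: "(real^'c^'r) set"
  where "nonneg_mat = {A. \<forall>i j. 0 \<le> A $ i $ j}"

definition max_times :: "real^'k^'r \<Rightarrow> real^'c^'k \<Rightarrow> real^'c^'r"  (infixl "\<otimes>" 70)
  where "A \<otimes> B = (\<chi> i j. MAX k. A $ i $ k * B $ k $ j)"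

definition max_trace :: "real^'n^'n \<Rightarrow> real"
  where "max_trace A = (MAX i. A $ i $ i)"

definition max_unitary :: "(real^'n^'n) set"
  where "max_unitary = {X \<in> nonneg_mat. transpose X \<otimes> X = mat 1}"

definition max_joint_C_range :: "real^'n^'n \<Rightarrow> (real^'n^'n)^'m \<Rightarrow> (real^'m) set"
  where "max_joint_C_range C A =
    {(\<chi> i. max_trace (C \<otimes> transpose X \<otimes> A $ i \<otimes> X)) | X. X \<in> max_unitary}"

end

(*
  On nonnegative matrices, max_times is associative, distributes over the
  entrywise maximum and has unit mat 1, while max_trace is additive, homogeneous, cyclic and
  transposition invariant.  A matrix X with X^t X = I in this algebra is a permutation matrix, so
  also X X^t = I, and max_unitary is closed under products and transposition.  Every assertion then
  follows for each single X, after substituting U X or X V^t for X where needed.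
*)
theory Submission
  imports Defs
begin

section \<open>Maxima over a finite index type\<close>

lemma MAX_le_iff:
  fixes f :: "'a::finite \<Rightarrow> 'b::linorder"
  shows "(MAX k. f k) \<le> z \<longleftrightarrow> (\<forall>k. f k \<le> z)"
  by (subst Max_le_iff) auto

lemma le_MAX:
  fixes f :: "'a::finite \<Rightarrow> 'b::linorder"
  shows "f k \<le> (MAX k. f k)"
  by (intro Max_ge) auto

lemma MAX_attained:
  fixes f :: "'a::finite \<Rightarrow> 'b::linorder"
  obtains k where "(MAX k. f k) = f k"
proof -
  have "(MAX k. f k) \<in> range f"
    by (intro Max_in) auto
  then show ?thesis
    using that by blast
qed

text \<open>A monotone map commutes with the maximum of a finite nonempty set, and
  \<open>0 \<le> c\<close> makes scaling by \<open>c\<close> monotone. This is the only route by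
  which factors enter or leave a maximum below.\<close>

lemma MAX_const_mult:
  fixes f :: "'a::finite \<Rightarrow> real"
  assumes "0 \<le> c"
  shows "(MAX k. c * f k) = c * (MAX k. f k)"
proof -
  have "mono (\<lambda>x. c * x)"
    using assms by (auto intro!: monoI mult_left_mono)
  from mono_Max_commute[OF this, of "range f"] show ?thesis
    by (simp add: image_image)
qed

lemma MAX_mult_const:
  fixes f :: "'a::finite \<Rightarrow> real"
  assumes "0 \<le> c"
  shows "(MAX k. f k * c) = (MAX k. f k) * c"
  using MAX_const_mult[OF assms, of f] by (simp add: mult.commute)

lemma MAX_sup:
  fixes f g :: "'a::finite \<Rightarrow> 'b::{linorder,lattice}"
  shows "(MAX k. sup (f k) (g k)) = sup (MAX k. f k) (MAX k. g k)"
proof (rule antisym)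
  show "(MAX k. sup (f k) (g k)) \<le> sup (MAX k. f k) (MAX k. g k)"
    by (auto simp: MAX_le_iff intro: sup.coboundedI1 sup.coboundedI2 le_MAX)
  have "f k \<le> (MAX k. sup (f k) (g k))" and "g k \<le> (MAX k. sup (f k) (g k))" for k
    using le_MAX[of "\<lambda>k. sup (f k) (g k)" k] by auto
  then show "sup (MAX k. f k) (MAX k. g k) \<le> (MAX k. sup (f k) (g k))"
    by (simp add: MAX_le_iff)
qed

text \<open>Both iterated maxima have the same upper bounds, namely the bounds of all
  \<open>f i j\<close>; antisymmetry then makes them equal.\<close>

lemma MAX_commute:
  fixes f :: "'a::finite \<Rightarrow> 'b::finite \<Rightarrow> 'c::linorder"
  shows "(MAX i. MAX j. f i j) = (MAX j. MAX i. f i j)"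
proof -
  have le_iff: "(MAX i. MAX j. f i j) \<le> z \<longleftrightarrow> (MAX j. MAX i. f i j) \<le> z" for z
    by (auto simp: MAX_le_iff)
  show ?thesis
    by (rule antisym) (rule le_iff[THEN iffD2] le_iff[THEN iffD1], rule order_refl)+
qed

lemma sup_mult_left:
  fixes c :: real
  assumes "0 \<le> c"
  shows "c * sup a b = sup (c * a) (c * b)"
  using assms by (simp add: sup_max max_mult_distrib_left)

lemma sup_mult_right:
  fixes c :: real
  assumes "0 \<le> c"
  shows "sup a b * c = sup (a * c) (b * c)"
  using assms by (simp add: sup_max max_mult_distrib_right)

section \<open>The max-times algebra of nonnegative matrices\<close>

lemma max_times_nth: "(A \<otimes> B) $ i $ j = (MAX k. A $ i $ k * B $ k $ j)"
  by (simp add: max_times_def)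

lemma nonneg_matD: "A \<in> nonneg_mat \<Longrightarrow> 0 \<le> A $ i $ j"
  by (simp add: nonneg_mat_def)

lemma nonneg_mat_max_times:
  assumes "A \<in> nonneg_mat" "B \<in> nonneg_mat"
  shows "A \<otimes> B \<in> nonneg_mat"
proof -
  have "0 \<le> (A \<otimes> B) $ i $ j" for i j
  proof -
    \<comment> \<open>Index types are nonempty, so one arbitrary \<open>k\<close> already supplies a
      nonnegative lower bound for the maximum.\<close>
    fix k
    have "0 \<le> A $ i $ k * B $ k $ j"
      using assms by (simp add: nonneg_matD)
    also have "\<dots> \<le> (A \<otimes> B) $ i $ j"
      unfolding max_times_nth by (rule le_MAX)
    finally show ?thesis .
  qed
  then show ?thesis
    by (simp add: nonneg_mat_def)
qed

lemma nonneg_mat_transpose: "A \<in> nonneg_mat \<Longrightarrow> transpose A \<in> nonneg_mat"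
  by (simp add: nonneg_mat_def transpose_def)

lemma nonneg_mat_mat_1: "mat 1 \<in> nonneg_mat"
  by (simp add: nonneg_mat_def mat_def)

text \<open>Entries of the outer factors \<open>A\<close> and \<open>C\<close> are moved into the
  inner maxima, which is where their signs matter. Both sides then are maxima of the same triple
  products, taken in opposite orders.\<close>

lemma max_times_assoc:
  assumes A: "A \<in> nonneg_mat" and C: "C \<in> nonneg_mat"
  shows "A \<otimes> B \<otimes> C = A \<otimes> (B \<otimes> C)"
proof -
  have "(A \<otimes> B \<otimes> C) $ i $ j = (A \<otimes> (B \<otimes> C)) $ i $ j" for i j
    unfolding max_times_nth
    by (simp add: MAX_mult_const[symmetric] MAX_const_mult[symmetric] A C nonneg_matD mult.assoc)
      (rule MAX_commute)
  then show ?thesis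
    by (simp add: vec_eq_iff)
qed

lemma max_times_sup_left:
  assumes "A \<in> nonneg_mat"
  shows "A \<otimes> (B \<oplus> C) = A \<otimes> B \<oplus> A \<otimes> C"
  by (simp add: vec_eq_iff max_times_nth sup_vec_def sup_mult_left assms nonneg_matD MAX_sup)

lemma max_times_sup_right:
  assumes "C \<in> nonneg_mat"
  shows "(A \<oplus> B) \<otimes> C = A \<otimes> C \<oplus> B \<otimes> C"
  by (simp add: vec_eq_iff max_times_nth sup_vec_def sup_mult_right assms nonneg_matD MAX_sup)

lemma max_times_scaleR_left: "0 \<le> a \<Longrightarrow> (a *\<^sub>R A) \<otimes> B = a *\<^sub>R (A \<otimes> B)"
  by (simp add: vec_eq_iff max_times_nth mult.assoc MAX_const_mult)

lemma max_times_scaleR_right: "0 \<le> a \<Longrightarrow> A \<otimes> (a *\<^sub>R B) = a *\<^sub>R (A \<otimes> B)"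
  by (simp add: vec_eq_iff max_times_nth mult.left_commute MAX_const_mult)

lemma transpose_max_times: "transpose (A \<otimes> B) = transpose B \<otimes> transpose A"
  by (simp add: vec_eq_iff max_times_nth transpose_def mult.commute)

text \<open>The zeros of the identity contribute terms 0 to the maximum; these are harmless because
  the entries of \<open>A\<close> are not below 0.\<close>

lemma max_times_mat_1_right:
  assumes "A \<in> nonneg_mat"
  shows "A \<otimes> mat 1 = A"
proof -
  have "(MAX k. A $ i $ k * mat 1 $ k $ j) = A $ i $ j" for i j
  proof (rule antisym)
    show "(MAX k. A $ i $ k * mat 1 $ k $ j) \<le> A $ i $ j"
      using assms by (simp add: MAX_le_iff mat_def nonneg_matD)
    show "A $ i $ j \<le> (MAX k. A $ i $ k * mat 1 $ k $ j)"
      using le_MAX[of "\<lambda>k. A $ i $ k * mat 1 $ k $ j" j] by (simp add: mat_def)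
  qed
  then show ?thesis
    by (simp add: vec_eq_iff max_times_nth)
qed

lemma max_times_mat_1_left:
  assumes "A \<in> nonneg_mat"
  shows "mat 1 \<otimes> A = A"
proof -
  have "transpose (mat 1 \<otimes> A) = transpose A"
    using assms
    by (simp add: transpose_max_times max_times_mat_1_right nonneg_mat_transpose)
  then show ?thesis
    by (metis transpose_transpose)
qed

section \<open>The max-algebraic trace\<close>

lemma max_trace_sup: "max_trace (A \<oplus> B) = max_trace A \<oplus> max_trace B"
  by (simp add: max_trace_def sup_vec_def MAX_sup)

lemma max_trace_scaleR: "0 \<le> a \<Longrightarrow> max_trace (a *\<^sub>R A) = a * max_trace A"
  by (simp add: max_trace_def MAX_const_mult)

lemma max_trace_transpose: "max_trace (transpose A) = max_trace A"
  by (simp add: max_trace_def transpose_def)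

text \<open>Both traces are the maximum of \<open>A $ i $ k * B $ k $ i\<close> over all pairs of
  indices.\<close>

lemma max_trace_commute: "max_trace (A \<otimes> B) = max_trace (B \<otimes> A)"
  unfolding max_trace_def max_times_nth by (subst MAX_commute) (simp add: mult.commute)

section \<open>Max-unitary matrices as permutation matrices\<close>

lemma max_unitaryD:
  assumes "X \<in> max_unitary"
  shows "X \<in> nonneg_mat" and "transpose X \<otimes> X = mat 1"
  using assms by (auto simp: max_unitary_def)

text \<open>The diagonal of \<open>transpose X \<otimes> X\<close> forces an entry 1 in every
  column; its zeros off the diagonal force a row with a 1 in column \<open>i\<close> to vanish in
  all other columns. Choosing the row of a 1 in each column gives \<sigma>.\<close>

lemma max_unitary_permutation:
  fixes X :: "real^'n^'n"
  assumes "X \<in> max_unitary"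
  obtains \<sigma> :: "'n \<Rightarrow> 'n"
  where "bij \<sigma>" and "X = (\<chi> i j. if i = \<sigma> j then 1 else 0)"
proof -
  have nn: "0 \<le> X $ i $ j" for i j
    using assms by (simp add: max_unitaryD nonneg_matD)
  have ent: "(MAX k. X $ k $ i * X $ k $ j) = (if i = j then 1 else 0)" for i j
  proof -
    have "(transpose X \<otimes> X) $ i $ j = mat 1 $ i $ j"
      using assms by (simp add: max_unitaryD)
    then show ?thesis
      by (simp add: max_times_nth transpose_def mat_def)
  qed
  have "\<exists>k. X $ k $ j = 1" for j
  proof -
    obtain k where "(MAX k. X $ k $ j * X $ k $ j) = X $ k $ j * X $ k $ j"
      by (rule MAX_attained)
    then have "(X $ k $ j)\<^sup>2 = 1"
      using ent[of j j] by (simp add: power2_eq_square)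
    then show ?thesis
      using nn[of k j] by (auto simp: power2_eq_1_iff)
  qed
  then obtain \<sigma> where \<sigma>: "\<And>j. X $ \<sigma> j $ j = 1"
    by metis
  \<comment> \<open>Since \<open>X $ \<sigma> i $ i\<close> is 1, the term at
    \<open>k = \<sigma> i\<close> is \<open>X $ \<sigma> i $ j\<close> itself, and the maximum
    bounding it is 0.\<close>
  have zero: "X $ \<sigma> i $ j = 0" if "i \<noteq> j" for i j
    using le_MAX[of "\<lambda>k. X $ k $ i * X $ k $ j" "\<sigma> i"] nn[of "\<sigma> i" j] that
    by (simp add: ent \<sigma>)
  have "inj \<sigma>"
  proof (rule injI, rule ccontr)
    fix i j
    assume "\<sigma> i = \<sigma> j" "i \<noteq> j"
    then show False
      using zero[of i j] \<sigma>[of j] by simp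
  qed
  then have bij: "bij \<sigma>"
    by (simp add: bij_def finite_UNIV_inj_surj)
  \<comment> \<open>By surjectivity every row has the form \<open>\<sigma> k\<close>, so the known
    ones and zeros account for every entry.\<close>
  have "X $ i $ j = (if i = \<sigma> j then 1 else 0)" for i j
    using bij zero \<sigma> by (metis bij_pointE)
  then show ?thesis
    using that bij by (simp add: vec_eq_iff)
qed

text \<open>Distinct rows of a permutation matrix never have a 1 in the same column. This makes the
  transpose a two-sided inverse, on which the reverse inclusions below rest.\<close>

lemma max_unitary_right_inverse:
  assumes "X \<in> max_unitary"
  shows "X \<otimes> transpose X = mat 1"
proof -
  obtain \<sigma> where bij: "bij \<sigma>" and X: "X = (\<chi> i j. if i = \<sigma> j then 1 else 0)"
    using assms by (rule max_unitary_permutation)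
  have "(MAX k. X $ i $ k * X $ j $ k) = (if i = j then 1 else 0)" for i j
  proof (rule antisym)
    show "(MAX k. X $ i $ k * X $ j $ k) \<le> (if i = j then 1 else 0)"
      by (auto simp: MAX_le_iff X)
    \<comment> \<open>The column in which row \<open>i\<close> has its 1; there the product attains
      1 when \<open>i = j\<close>.\<close>
    obtain k where "\<sigma> k = i"
      using bij by (metis bij_pointE)
    then show "(if i = j then 1 else 0) \<le> (MAX k. X $ i $ k * X $ j $ k)"
      using le_MAX[of "\<lambda>k. X $ i $ k * X $ j $ k" k] by (auto simp: X)
  qed
  then show ?thesis
    by (simp add: vec_eq_iff max_times_nth transpose_def mat_def)
qed

lemma max_unitary_transpose: "X \<in> max_unitary \<Longrightarrow> transpose X \<in> max_unitary"
  using max_unitary_right_inverse[of X]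
  by (simp add: max_unitary_def nonneg_mat_transpose)

lemma max_unitary_mat_1: "mat 1 \<in> max_unitary"
  by (simp add: max_unitary_def nonneg_mat_mat_1 max_times_mat_1_left)

lemma max_unitary_max_times:
  assumes X: "X \<in> max_unitary" and Y: "Y \<in> max_unitary"
  shows "X \<otimes> Y \<in> max_unitary"
proof -
  note nn = max_unitaryD(1)[OF X] max_unitaryD(1)[OF Y]
  have "transpose (X \<otimes> Y) \<otimes> (X \<otimes> Y) = transpose Y \<otimes> (transpose X \<otimes> X \<otimes> Y)"
    by (simp add: transpose_max_times max_times_assoc nn nonneg_mat_transpose nonneg_mat_max_times)
  also have "\<dots> = mat 1"
    by (simp add: max_unitaryD X Y max_times_mat_1_left)
  finally show ?thesis
    by (simp add: max_unitary_def nn nonneg_mat_max_times)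
qed

text \<open>Cyclicity brings \<open>X\<close> next to its transpose, and the two cancel.\<close>

lemma max_trace_conj:
  assumes "X \<in> max_unitary" "A \<in> nonneg_mat"
  shows "max_trace (transpose X \<otimes> A \<otimes> X) = max_trace A"
proof -
  have "max_trace (transpose X \<otimes> A \<otimes> X) = max_trace (X \<otimes> transpose X \<otimes> A)"
    using assms
    by (subst max_trace_commute) (simp add: max_times_assoc max_unitaryD nonneg_mat_max_times)
  then show ?thesis
    using assms by (simp add: max_unitary_right_inverse max_times_mat_1_left)
qed

section \<open>Symmetries of the range: conjugation and transposition\<close>

lemma max_joint_C_range_image:
  "max_joint_C_range C A
    = (\<lambda>X. \<chi> i. max_trace (C \<otimes> transpose X \<otimes> A $ i \<otimes> X)) ` max_unitary"
  by (auto simp: max_joint_C_range_def)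

lemma max_plus_set_singleton: "S \<oplus>\<^sub>S {t} = (\<lambda>s. s \<oplus> t) ` S"
  by (auto simp: max_plus_set_def)

lemma scale_set_image: "a *\<^sub>S S = (\<lambda>s. a *\<^sub>R s) ` S"
  by (auto simp: scale_set_def)

text \<open>The point given by \<open>X\<close> on the left is the point given by
  \<open>U \<otimes> X\<close> on the right. The converse inclusion will follow by applying this one
  to the inverse of \<open>U\<close>.\<close>

lemma max_joint_C_range_conj_subset:
  fixes A :: "(real^'n^'n)^'m"
  assumes U: "U \<in> max_unitary" and C: "C \<in> nonneg_mat" and A: "\<And>i. A $ i \<in> nonneg_mat"
  shows "max_joint_C_range C (\<chi> i. transpose U \<otimes> A $ i \<otimes> U) \<subseteq> max_joint_C_range C A"
proof -
  have "C \<otimes> transpose X \<otimes> (transpose U \<otimes> A $ i \<otimes> U) \<otimes> X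
      = C \<otimes> transpose (U \<otimes> X) \<otimes> A $ i \<otimes> (U \<otimes> X)" if "X \<in> max_unitary" for X i
    by (simp add: transpose_max_times max_times_assoc max_unitaryD that U C A
        nonneg_mat_transpose nonneg_mat_max_times)
  then show ?thesis
    unfolding max_joint_C_range_def using max_unitary_max_times[OF U] by fastforce
qed

lemma max_joint_C_range_conj:
  fixes A :: "(real^'n^'n)^'m"
  assumes U: "U \<in> max_unitary" and C: "C \<in> nonneg_mat" and A: "\<And>i. A $ i \<in> nonneg_mat"
  shows "max_joint_C_range C (\<chi> i. transpose U \<otimes> A $ i \<otimes> U) = max_joint_C_range C A"
proof
  let ?B = "(\<chi> i. transpose U \<otimes> A $ i \<otimes> U) :: (real^'n^'n)^'m"
  note nn = A C max_unitaryD(1)[OF U] nonneg_mat_transpose nonneg_mat_max_times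
  \<comment> \<open>Conjugating \<open>?B\<close> by \<open>transpose U\<close> recovers
    \<open>A\<close>, so the inclusion already proved also yields the reverse one.\<close>
  have "transpose (transpose U) \<otimes> ?B $ i \<otimes> transpose U = A $ i" for i
  proof -
    have "transpose (transpose U) \<otimes> ?B $ i \<otimes> transpose U
        = U \<otimes> transpose U \<otimes> A $ i \<otimes> (U \<otimes> transpose U)"
      by (simp add: max_times_assoc nn)
    then show ?thesis
      by (simp add: max_unitary_right_inverse U max_times_mat_1_left max_times_mat_1_right A)
  qed
  then have "(\<chi> i. transpose (transpose U) \<otimes> ?B $ i \<otimes> transpose U) = A"
    by (simp add: vec_eq_iff)
  moreover have "?B $ i \<in> nonneg_mat" for i
    by (simp add: nn)
  ultimately show "max_joint_C_range C A \<subseteq> max_joint_C_range C ?B"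
    using max_joint_C_range_conj_subset[OF max_unitary_transpose[OF U] C, of ?B] by simp
qed (rule max_joint_C_range_conj_subset[OF assms])

text \<open>The same \<open>X\<close> gives the same point on both sides: transposing inside the
  trace reverses the product, and a cyclic shift returns \<open>transpose C\<close> to the
  front.\<close>

lemma max_joint_C_range_transpose:
  fixes A :: "(real^'n^'n)^'m"
  assumes C: "C \<in> nonneg_mat" and A: "\<And>i. A $ i \<in> nonneg_mat"
  shows "max_joint_C_range C (\<chi> i. transpose (A $ i)) = max_joint_C_range (transpose C) A"
proof -
  have "max_trace (C \<otimes> transpose X \<otimes> transpose (A $ i) \<otimes> X)
      = max_trace (transpose C \<otimes> transpose X \<otimes> A $ i \<otimes> X)" if "X \<in> max_unitary" for X i
  proof -
    note nn = A C max_unitaryD(1)[OF that] nonneg_mat_transpose nonneg_mat_max_times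
    have "max_trace (C \<otimes> transpose X \<otimes> transpose (A $ i) \<otimes> X)
        = max_trace (transpose (C \<otimes> transpose X \<otimes> transpose (A $ i) \<otimes> X))"
      by (simp add: max_trace_transpose)
    also have "\<dots> = max_trace (transpose X \<otimes> A $ i \<otimes> X \<otimes> transpose C)"
      by (simp add: transpose_max_times max_times_assoc nn)
    also have "\<dots> = max_trace (transpose C \<otimes> (transpose X \<otimes> A $ i \<otimes> X))"
      by (rule max_trace_commute)
    finally show ?thesis
      by (simp add: max_times_assoc nn)
  qed
  then show ?thesis
    unfolding max_joint_C_range_def by (intro Collect_cong ex_cong1) auto
qed

text \<open>A cyclic shift carries the leading \<open>transpose V\<close> to the end of the product,
  so that \<open>X\<close> is replaced by \<open>X \<otimes> transpose V\<close>.\<close>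

lemma max_joint_C_range_conj_left_subset:
  fixes A :: "(real^'n^'n)^'m"
  assumes V: "V \<in> max_unitary" and C: "C \<in> nonneg_mat" and A: "\<And>i. A $ i \<in> nonneg_mat"
  shows "max_joint_C_range (transpose V \<otimes> C \<otimes> V) A \<subseteq> max_joint_C_range C A"
proof -
  have "max_trace (transpose V \<otimes> C \<otimes> V \<otimes> transpose X \<otimes> A $ i \<otimes> X)
      = max_trace (C \<otimes> transpose (X \<otimes> transpose V) \<otimes> A $ i \<otimes> (X \<otimes> transpose V))"
    if "X \<in> max_unitary" for X i
  proof -
    note nn = A C max_unitaryD(1)[OF V] max_unitaryD(1)[OF that]
      nonneg_mat_transpose nonneg_mat_max_times
    have "max_trace (transpose V \<otimes> C \<otimes> V \<otimes> transpose X \<otimes> A $ i \<otimes> X)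
        = max_trace (transpose V \<otimes> (C \<otimes> V \<otimes> transpose X \<otimes> A $ i \<otimes> X))"
      by (simp add: max_times_assoc nn)
    also have "\<dots> = max_trace (C \<otimes> V \<otimes> transpose X \<otimes> A $ i \<otimes> X \<otimes> transpose V)"
      by (rule max_trace_commute)
    finally show ?thesis
      by (simp add: transpose_max_times max_times_assoc nn)
  qed
  then show ?thesis
    unfolding max_joint_C_range_def
    using max_unitary_max_times[OF _ max_unitary_transpose[OF V]] by fastforce
qed

lemma max_joint_C_range_conj_left:
  fixes A :: "(real^'n^'n)^'m"
  assumes V: "V \<in> max_unitary" and C: "C \<in> nonneg_mat" and A: "\<And>i. A $ i \<in> nonneg_mat"
  shows "max_joint_C_range (transpose V \<otimes> C \<otimes> V) A = max_joint_C_range C A"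
proof
  let ?D = "transpose V \<otimes> C \<otimes> V"
  note nn = C max_unitaryD(1)[OF V] nonneg_mat_transpose nonneg_mat_max_times
  \<comment> \<open>As before, undoing the conjugation by \<open>transpose V\<close> turns the
    proved inclusion into its converse.\<close>
  have "transpose (transpose V) \<otimes> ?D \<otimes> transpose V = V \<otimes> transpose V \<otimes> C \<otimes> (V \<otimes> transpose V)"
    by (simp add: max_times_assoc nn)
  also have "\<dots> = C"
    by (simp add: max_unitary_right_inverse V max_times_mat_1_left max_times_mat_1_right C)
  finally show "max_joint_C_range C A \<subseteq> max_joint_C_range ?D A"
    using max_joint_C_range_conj_left_subset[OF max_unitary_transpose[OF V] _ A, of ?D]
    by (simp add: nn)
qed (rule max_joint_C_range_conj_left_subset[OF assms])

section \<open>Max sums and scalar matrices\<close>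

lemma max_joint_C_range_sup_scalar:
  fixes A :: "(real^'n^'n)^'m" and a :: "real^'m"
  assumes C: "C \<in> nonneg_mat" and a: "\<And>i. 0 \<le> a $ i"
  shows "max_joint_C_range C (\<chi> i. A $ i \<oplus> a $ i *\<^sub>R mat 1)
    = max_joint_C_range C A \<oplus>\<^sub>S {max_trace C *\<^sub>R a}"
proof -
  have "(\<chi> i. max_trace (C \<otimes> transpose X \<otimes> (\<chi> i. A $ i \<oplus> a $ i *\<^sub>R mat 1) $ i \<otimes> X))
      = (\<chi> i. max_trace (C \<otimes> transpose X \<otimes> A $ i \<otimes> X)) \<oplus> max_trace C *\<^sub>R a"
    if "X \<in> max_unitary" for X
  proof -
    note nn = C max_unitaryD(1)[OF that] nonneg_mat_transpose nonneg_mat_max_times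
    \<comment> \<open>The scalar summand thus contributes \<open>a $ i * max_trace C\<close>
      whatever \<open>X\<close> is, which is why a single point is added to the range.\<close>
    have "C \<otimes> transpose X \<otimes> X = C"
      using that by (simp add: max_times_assoc nn max_unitaryD max_times_mat_1_right)
    then have "max_trace (C \<otimes> transpose X \<otimes> (A $ i \<oplus> a $ i *\<^sub>R mat 1) \<otimes> X)
        = max_trace (C \<otimes> transpose X \<otimes> A $ i \<otimes> X) \<oplus> max_trace C * a $ i" for i
      by (simp add: max_times_sup_left max_times_sup_right nn max_trace_sup a
          max_times_scaleR_left max_times_scaleR_right max_times_mat_1_right max_trace_scaleR
          mult.commute)
    then show ?thesis
      by (simp add: vec_eq_iff max_plus_component)
  qed
  then show ?thesis
    by (simp add: max_joint_C_range_image max_plus_set_singleton image_image cong: image_cong_simp)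
qed

text \<open>For each single \<open>X\<close> the points add up exactly. Only an inclusion results,
  because the set on the right also combines points coming from different matrices.\<close>

lemma max_joint_C_range_sup_right_subset:
  fixes A B :: "(real^'n^'n)^'m"
  assumes C: "C \<in> nonneg_mat"
  shows "max_joint_C_range C (A \<oplus> B) \<subseteq> max_joint_C_range C A \<oplus>\<^sub>S max_joint_C_range C B"
proof -
  have "(\<chi> i. max_trace (C \<otimes> transpose X \<otimes> (A \<oplus> B) $ i \<otimes> X))
      = (\<chi> i. max_trace (C \<otimes> transpose X \<otimes> A $ i \<otimes> X))
        \<oplus> (\<chi> i. max_trace (C \<otimes> transpose X \<otimes> B $ i \<otimes> X))" if "X \<in> max_unitary" for X
    using C max_unitaryD(1)[OF that]
    by (simp add: vec_eq_iff max_plus_component max_times_sup_left max_times_sup_right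
        nonneg_mat_transpose nonneg_mat_max_times max_trace_sup)
  then show ?thesis
    unfolding max_joint_C_range_def max_plus_set_def by blast
qed

lemma max_joint_C_range_sup_left_subset:
  fixes A :: "(real^'n^'n)^'m"
  assumes A: "\<And>i. A $ i \<in> nonneg_mat"
  shows "max_joint_C_range (C \<oplus> D) A \<subseteq> max_joint_C_range C A \<oplus>\<^sub>S max_joint_C_range D A"
proof -
  have "(\<chi> i. max_trace ((C \<oplus> D) \<otimes> transpose X \<otimes> A $ i \<otimes> X))
      = (\<chi> i. max_trace (C \<otimes> transpose X \<otimes> A $ i \<otimes> X))
        \<oplus> (\<chi> i. max_trace (D \<otimes> transpose X \<otimes> A $ i \<otimes> X))" if "X \<in> max_unitary" for X
    using A max_unitaryD(1)[OF that]
    by (simp add: vec_eq_iff max_plus_component max_times_sup_right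
        nonneg_mat_transpose max_trace_sup)
  then show ?thesis
    unfolding max_joint_C_range_def max_plus_set_def by blast
qed

text \<open>The value is independent of \<open>X\<close>; this serves both the scalar case of
  \<open>C\<close> and the scalar summand added to \<open>C\<close>.\<close>

lemma max_trace_scaled_mat_1_conj:
  assumes "0 \<le> b" "X \<in> max_unitary" "A \<in> nonneg_mat"
  shows "max_trace (b *\<^sub>R mat 1 \<otimes> transpose X \<otimes> A \<otimes> X) = b * max_trace A"
  using assms
  by (simp add: max_times_scaleR_left max_times_mat_1_left max_unitaryD nonneg_mat_transpose
      max_trace_scaleR max_trace_conj)

lemma max_joint_C_range_scaled_mat_1:
  fixes A :: "(real^'n^'n)^'m"
  assumes "\<And>i. A $ i \<in> nonneg_mat" "0 \<le> b"
  shows "max_joint_C_range (b *\<^sub>R mat 1) A = {b *\<^sub>R (\<chi> i. max_trace (A $ i))}"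
proof -
  have "(\<chi> i. max_trace (b *\<^sub>R mat 1 \<otimes> transpose X \<otimes> A $ i \<otimes> X)) = b *\<^sub>R (\<chi> i. max_trace (A $ i))"
    if "X \<in> max_unitary" for X
    using that assms by (simp add: vec_eq_iff max_trace_scaled_mat_1_conj)
  then show ?thesis
    \<comment> \<open>The map is constant on \<open>max_unitary\<close>; the member
      \<open>mat 1\<close> ensures that its image is the singleton and not empty.\<close>
    using max_unitary_mat_1 by (auto simp: max_joint_C_range_image)
qed

text \<open>The second summand does not vary with \<open>X\<close>, so the splitting for each
  \<open>X\<close> gives an equality of sets.\<close>

lemma max_joint_C_range_sup_scaled_mat_1:
  fixes A :: "(real^'n^'n)^'m"
  assumes A: "\<And>i. A $ i \<in> nonneg_mat" and ab: "0 \<le> a" "0 \<le> b"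
  shows "max_joint_C_range (a *\<^sub>R C \<oplus> b *\<^sub>R mat 1) A
    = a *\<^sub>S max_joint_C_range C A \<oplus>\<^sub>S {b *\<^sub>R (\<chi> i. max_trace (A $ i))}"
proof -
  have "(\<chi> i. max_trace ((a *\<^sub>R C \<oplus> b *\<^sub>R mat 1) \<otimes> transpose X \<otimes> A $ i \<otimes> X))
      = a *\<^sub>R (\<chi> i. max_trace (C \<otimes> transpose X \<otimes> A $ i \<otimes> X)) \<oplus> b *\<^sub>R (\<chi> i. max_trace (A $ i))"
    if "X \<in> max_unitary" for X
  proof -
    have "max_trace ((a *\<^sub>R C \<oplus> b *\<^sub>R mat 1) \<otimes> transpose X \<otimes> A $ i \<otimes> X)
      = max_trace (a *\<^sub>R (C \<otimes> transpose X \<otimes> A $ i \<otimes> X))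
        \<oplus> max_trace (b *\<^sub>R mat 1 \<otimes> transpose X \<otimes> A $ i \<otimes> X)" for i
      using that A ab
      by (simp add: max_times_sup_right max_times_scaleR_left max_unitaryD nonneg_mat_transpose
          max_trace_sup)
    then show ?thesis
      using that A ab
      by (simp add: vec_eq_iff max_plus_component max_trace_scaleR max_trace_scaled_mat_1_conj)
  qed
  then show ?thesis
    by (simp add: max_joint_C_range_image max_plus_set_singleton scale_set_image image_image
        cong: image_cong_simp)
qed

theorem theorem5p12:
  fixes A :: "(real^'n^'n)^'m" and C :: "real^'n^'n"
  assumes A: "\<And>i. A $ i \<in> nonneg_mat" and C: "C \<in> nonneg_mat"
  shows
    "(\<forall>a :: real^'m. (\<forall>i. 0 \<le> a $ i) \<longrightarrow>
        max_joint_C_range C (\<chi> i. A $ i \<oplus> a $ i *\<^sub>R mat 1)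
          = max_joint_C_range C A \<oplus>\<^sub>S {max_trace C *\<^sub>R a})
   \<and> (\<forall>B :: (real^'n^'n)^'m. (\<forall>i. B $ i \<in> nonneg_mat) \<longrightarrow>
        max_joint_C_range C (A \<oplus> B)
          \<subseteq> max_joint_C_range C A \<oplus>\<^sub>S max_joint_C_range C B)
   \<and> (\<forall>D \<in> nonneg_mat.
        max_joint_C_range (C \<oplus> D) A
          \<subseteq> max_joint_C_range C A \<oplus>\<^sub>S max_joint_C_range D A)
   \<and> (\<forall>U \<in> max_unitary.
        max_joint_C_range C (\<chi> i. transpose U \<otimes> A $ i \<otimes> U) = max_joint_C_range C A)
   \<and> max_joint_C_range C (\<chi> i. transpose (A $ i)) = max_joint_C_range (transpose C) A
   \<and> (\<forall>\<alpha>::real. 0 \<le> \<alpha> \<and> C = \<alpha> *\<^sub>R mat 1 \<longrightarrow>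
        max_joint_C_range C A = {\<alpha> *\<^sub>R (\<chi> i. max_trace (A $ i))})
   \<and> (\<forall>\<alpha> \<beta> :: real. 0 \<le> \<alpha> \<and> 0 \<le> \<beta> \<longrightarrow>
        max_joint_C_range (\<alpha> *\<^sub>R C \<oplus> \<beta> *\<^sub>R mat 1) A
          = \<alpha> *\<^sub>S max_joint_C_range C A \<oplus>\<^sub>S {\<beta> *\<^sub>R (\<chi> i. max_trace (A $ i))})
   \<and> (\<forall>V \<in> max_unitary.
        max_joint_C_range (transpose V \<otimes> C \<otimes> V) A = max_joint_C_range C A)"
  \<comment> \<open>The inclusions are closed by resolution and the equations by rewriting; in the
    scalar case the premise on \<open>C\<close> itself serves as a rewrite rule.\<close>
  by (intro conjI allI ballI impI)
    (rule max_joint_C_range_sup_right_subset[OF C] max_joint_C_range_sup_left_subset[OF A]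
      | simp only: max_joint_C_range_sup_scalar[OF C] max_joint_C_range_conj[OF _ C A]
          max_joint_C_range_transpose[OF C A] max_joint_C_range_scaled_mat_1[OF A]
          max_joint_C_range_sup_scaled_mat_1[OF A] max_joint_C_range_conj_left[OF _ C A])+

end
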